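(* Let $n\ge2$. If $\mu$ is a Radon measure on $\mathbb{R}^n$ whose support is the compact set $\Gamma$ and $\mu$ is upper $d$-regular on $\Gamma$, for some $d\in(n-2,n]$, i.e. for some $c>0$ $$\mu(B_r(x))\le c\,r^d,\qquad x\in\Gamma,\ 0<r\le1,$$ then $$\sup_{x\in\mathbb{R}^n}\int_{B_r(x)}f_n(|x-y|)\,d\mu(y)\to0\quad\text{as}\quad r\to0^+,$$ where $f_n(r):=|\log r|$ if $n=2$ and $f_n(r):=r^{2-n}$ if $n>2$.
   Context: A Radon measure is a positive regular Borel measure that is finite on compact sets. $B_r(x):=\{y\in\mathbb{R}^n:|x-y|\le r\}$ is the closed ball. *)

theory Defs
  imports "HOL-Analysis.Analysis"
begin

text \<open>
  Inner regularity is required on all Borel sets, not only on open ones; on Euclidean space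
  the two conventions agree.
\<close>

definition radon_measure :: "'a::topological_space measure \<Rightarrow> bool" where
  "radon_measure \<mu> \<longleftrightarrow>
     sets \<mu> = sets borel \<and>
     (\<forall>K. compact K \<longrightarrow> emeasure \<mu> K < \<infinity>) \<and>
     (\<forall>A\<in>sets borel. emeasure \<mu> A = (INF U\<in>{U. open U \<and> A \<subseteq> U}. emeasure \<mu> U)) \<and>
     (\<forall>A\<in>sets borel. emeasure \<mu> A = (SUP K\<in>{K. compact K \<and> K \<subseteq> A}. emeasure \<mu> K))"

definition measure_support :: "'a::topological_space measure \<Rightarrow> 'a set" where
  "measure_support \<mu> = {x. \<forall>U. open U \<and> x \<in> U \<longrightarrow> emeasure \<mu> U > 0}"

definition upper_regular_on :: "'a::metric_space measure \<Rightarrow> real \<Rightarrow> 'a set \<Rightarrow> bool" where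
  "upper_regular_on \<mu> d \<Gamma> \<longleftrightarrow>
     (\<exists>c>0. \<forall>x\<in>\<Gamma>. \<forall>r. 0 < r \<and> r \<le> 1 \<longrightarrow> emeasure \<mu> (cball x r) \<le> ennreal (c * r powr d))"

text \<open>
  The kernel takes its limit value \<open>\<infinity>\<close> at \<open>0\<close>, where the library's \<open>ln\<close> and \<open>powi\<close> (with
  negative exponent) would both return \<open>0\<close>. Only \<open>n \<ge> 2\<close> and \<open>r \<ge> 0\<close> are meaningful.
\<close>

definition f_kernel :: "nat \<Rightarrow> real \<Rightarrow> ennreal" where
  "f_kernel n r =
     (if r = 0 then \<infinity>
      else if n = 2 then ennreal \<bar>ln r\<bar>
      else ennreal (r powi (2 - int n)))"

end

theory Submission
  imports Defs
begin

text \<open>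
  Near the pole the kernel is dominated by a power \<open>M * t powr (-s)\<close> with an exponent
  \<open>0 < s < d\<close>: for \<open>n > 2\<close> the kernel itself is such a power with \<open>s = n - 2\<close>, and for
  \<open>n = 2\<close> the logarithm is dominated by every negative power (lemma \<open>f_kernel_le_powr\<close>).
  This is where \<open>d > n - 2\<close> enters.

  The growth bound \<open>\<mu> (cball x r) \<le> C * r powr d\<close> is assumed for centres in the support only,
  but after doubling the radius it holds for every centre (lemma \<open>upper_regular_all_centres\<close>):
  a ball that meets the support lies in a ball of twice the radius centred there, and a ball
  that misses the support has measure zero.

  A dyadic decomposition then gives, uniformly in the centre \<open>x\<close>,
  \<open>\<integral> dist x y powr (-s) d\<mu>(y) \<le> \<Sum>k. (r / 2^(k+1)) powr (-s) * C * (r / 2^k) powr d\<close>,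
  the integral being taken over the ball of radius \<open>r\<close>.
  The right-hand side is a geometric series of ratio \<open>2 powr (s - d) < 1\<close> and equals a constant
  times \<open>r powr (d - s)\<close>, which tends to \<open>0\<close> (lemma \<open>nn_integral_singular_cball_le\<close>).
\<close>

text \<open>
  Every point of \<open>K\<close> has an open null neighbourhood, and by compactness finitely many of them
  cover \<open>K\<close>.
\<close>

lemma emeasure_compact_disjoint_support:
  fixes \<mu> :: "'a::topological_space measure"
  assumes sets: "sets \<mu> = sets borel" and K: "compact K" "K \<inter> measure_support \<mu> = {}"
  shows "emeasure \<mu> K = 0"
proof -
  let ?C = "{U. open U \<and> emeasure \<mu> U = 0}"
  have "\<exists>U\<in>?C. x \<in> U" if "x \<in> K" for x
  proof -
    have "x \<notin> measure_support \<mu>" using K(2) that by blast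
    then obtain U where "open U" "x \<in> U" "\<not> emeasure \<mu> U > 0"
      unfolding measure_support_def by blast
    thus ?thesis by (intro bexI[of _ U]) (simp_all add: not_gr_zero)
  qed
  hence "K \<subseteq> \<Union>?C" by blast
  moreover have "\<And>U. U \<in> ?C \<Longrightarrow> open U" by simp
  ultimately obtain D where D: "D \<subseteq> ?C" "finite D" "K \<subseteq> \<Union>D"
    by (rule compactE[OF K(1)])
  have "D \<subseteq> null_sets \<mu>"
    using D(1) sets by (auto simp: null_sets_def)
  hence "\<Union>D \<in> null_sets \<mu>"
    by (intro null_sets.finite_Union D(2))
  thus ?thesis
    using emeasure_mono[OF D(3), of \<mu>] by (simp add: null_sets_def)
qed

lemma upper_regular_all_centres:
  fixes \<mu> :: "'a::heine_borel measure"
  assumes sets: "sets \<mu> = sets borel" and reg: "upper_regular_on \<mu> d (measure_support \<mu>)"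
  obtains C where "C > 0"
    "\<And>x r. 0 < r \<Longrightarrow> r \<le> 1 / 2 \<Longrightarrow> emeasure \<mu> (cball x r) \<le> ennreal (C * r powr d)"
proof -
  obtain c where c: "c > 0" and
    bound: "\<And>x r. x \<in> measure_support \<mu> \<Longrightarrow> 0 < r \<Longrightarrow> r \<le> 1 \<Longrightarrow>
      emeasure \<mu> (cball x r) \<le> ennreal (c * r powr d)"
    using reg unfolding upper_regular_on_def by blast
  show thesis
  proof
    show "c * 2 powr d > 0" using c by simp
    fix x :: 'a and r :: real
    assume r: "0 < r" "r \<le> 1 / 2"
    show "emeasure \<mu> (cball x r) \<le> ennreal (c * 2 powr d * r powr d)"
    proof (cases "cball x r \<inter> measure_support \<mu> = {}")
      case True
      thus ?thesis
        using emeasure_compact_disjoint_support[OF sets compact_cball] by simp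
    next
      case False
      then obtain z where z: "dist x z \<le> r" "z \<in> measure_support \<mu>" by auto
      have "cball x r \<subseteq> cball z (2 * r)"
      proof
        fix y assume "y \<in> cball x r"
        thus "y \<in> cball z (2 * r)"
          using z(1) dist_triangle3[of z y x] by simp
      qed
      hence "emeasure \<mu> (cball x r) \<le> emeasure \<mu> (cball z (2 * r))"
        by (intro emeasure_mono) (auto simp: sets)
      also have "\<dots> \<le> ennreal (c * (2 * r) powr d)"
        using bound[OF z(2), of "2 * r"] r by simp
      finally show ?thesis using r by (simp add: powr_mult mult.assoc)
    qed
  qed
qed

text \<open>
  The first dyadic radius \<open>r / 2^(k+1)\<close> that drops below \<open>t\<close> gives the summand that dominates.
  Balls are used instead of annuli because then, at \<open>t = 0\<close>, all summands are present and the
  series diverges, so the estimate also covers the value \<open>\<infinity>\<close> of the kernel at its pole.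
\<close>

lemma singular_kernel_le_dyadic_sum:
  fixes g :: "real \<Rightarrow> ennreal"
  assumes g: "\<And>t. 0 < t \<Longrightarrow> t \<le> r \<Longrightarrow> g t \<le> ennreal (M * t powr (-s))"
    and pos: "M > 0" "s > 0" and t: "0 \<le> t" "t \<le> r" and r: "0 < r"
  shows "g t \<le> (\<Sum>k. ennreal (M * (r / 2 ^ Suc k) powr (-s)) * indicator {..r / 2 ^ k} t)"
    (is "_ \<le> (\<Sum>k. ?a k)")
proof (cases "t = 0")
  case True
  have "ennreal (M * r powr (-s)) \<le> ?a k" for k
  proof -
    have "r / 2 ^ Suc k \<le> r"
      using r by (simp add: divide_le_eq mult_le_cancel_left1 del: power_Suc)
    hence "r powr (-s) \<le> (r / 2 ^ Suc k) powr (-s)"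
      using r pos by (intro powr_mono2') auto
    thus ?thesis using True r pos by (auto intro!: ennreal_leI)
  qed
  hence "(\<Sum>k::nat. ennreal (M * r powr (-s))) \<le> (\<Sum>k. ?a k)"
    by (intro suminf_le) auto
  moreover have "(\<Sum>k::nat. ennreal (M * r powr (-s))) = top"
    using pos r by (intro summable_iff_suminf_neq_top) (auto simp: summable_const_iff)
  ultimately show ?thesis by (simp add: top_unique)
next
  case False
  hence t0: "t > 0" using t by simp
  have "(\<lambda>k. r * (1 / 2) ^ Suc k) \<longlonglongrightarrow> r * 0"
    by (intro tendsto_mult tendsto_const LIMSEQ_Suc LIMSEQ_realpow_zero) auto
  hence "\<forall>\<^sub>F k in sequentially. r * (1 / 2) ^ Suc k < t"
    using t0 by (intro order_tendstoD) auto
  hence ex: "\<exists>k. r / 2 ^ Suc k < t"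
    by (auto simp: eventually_sequentially power_divide simp del: power_Suc)
  define k where "k = (LEAST k. r / 2 ^ Suc k < t)"
  have k1: "r / 2 ^ Suc k < t"
    using LeastI_ex[OF ex] by (simp add: k_def)
  have k2: "t \<le> r / 2 ^ k"
  proof (cases k)
    case 0
    thus ?thesis using t by simp
  next
    case (Suc j)
    hence "\<not> r / 2 ^ Suc j < t"
      using not_less_Least[of j "\<lambda>k. r / 2 ^ Suc k < t"] by (simp add: k_def del: power_Suc)
    thus ?thesis using Suc by (simp del: power_Suc)
  qed
  have "t powr (-s) \<le> (r / 2 ^ Suc k) powr (-s)"
    using k1 r pos by (intro powr_mono2') auto
  hence "ennreal (M * t powr (-s)) \<le> ?a k"
    using k2 pos by (auto intro!: ennreal_leI)
  also have "\<dots> = (\<Sum>j\<in>{k}. ?a j)"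
    by (simp only: sum.insert sum.empty finite.emptyI empty_iff not_False_eq_True add_0_right)
  also have "\<dots> \<le> (\<Sum>j. ?a j)"
    by (intro sum_le_suminf) auto
  finally show ?thesis using g[OF t0 t(2)] by (rule order_trans[rotated])
qed

lemma nn_integral_singular_cball_le:
  fixes \<mu> :: "'a::metric_space measure" and g :: "real \<Rightarrow> ennreal"
  assumes sets: "sets \<mu> = sets borel"
    and ball: "\<And>\<rho>. 0 < \<rho> \<Longrightarrow> \<rho> \<le> r \<Longrightarrow> emeasure \<mu> (cball x \<rho>) \<le> ennreal (C * \<rho> powr d)"
    and g: "\<And>t. 0 < t \<Longrightarrow> t \<le> r \<Longrightarrow> g t \<le> ennreal (M * t powr (-s))"
    and pos: "C > 0" "M > 0" "s > 0" "s < d" "r > 0"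
  shows "(\<integral>\<^sup>+ y \<in> cball x r. g (dist x y) \<partial>\<mu>)
    \<le> ennreal (M * C * 2 powr s / (1 - 2 powr (s - d)) * r powr (d - s))"
proof -
  define q :: real where "q = 2 powr (s - d)"
  have q: "0 < q" "q < 1"
    using pos by (auto simp: q_def powr_less_one)
  let ?w = "\<lambda>k. ennreal (M * (r / 2 ^ Suc k) powr (-s))"
  let ?B = "\<lambda>k. cball x (r / 2 ^ k)"
  have "(\<integral>\<^sup>+ y \<in> cball x r. g (dist x y) \<partial>\<mu>) \<le> (\<integral>\<^sup>+ y. (\<Sum>k. ?w k * indicator (?B k) y) \<partial>\<mu>)"
  proof (rule nn_integral_mono)
    fix y
    show "g (dist x y) * indicator (cball x r) y \<le> (\<Sum>k. ?w k * indicator (?B k) y)"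
    proof (cases "dist x y \<le> r")
      case True
      have "indicator {..r / 2 ^ k} (dist x y) = (indicator (?B k) y :: ennreal)" for k
        by (simp add: indicator_def)
      thus ?thesis
        using singular_kernel_le_dyadic_sum[of r g M s "dist x y"] g pos True by simp
    qed simp
  qed
  also have "\<dots> = (\<Sum>k. \<integral>\<^sup>+ y. ?w k * indicator (?B k) y \<partial>\<mu>)"
    by (intro nn_integral_suminf borel_measurable_times_ennreal borel_measurable_const
          borel_measurable_indicator) (simp add: sets)
  also have "\<dots> = (\<Sum>k. ?w k * emeasure \<mu> (?B k))"
    by (simp add: nn_integral_cmult_indicator sets del: power_Suc)
  also have "\<dots> \<le> (\<Sum>k. ennreal (M * C * 2 powr s * r powr (d - s) * q ^ k))"
  proof (intro suminf_le summableI)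
    fix k
    have "r / 2 ^ k \<le> r"
      using pos by (simp add: divide_le_eq mult_le_cancel_left1)
    hence "?w k * emeasure \<mu> (?B k) \<le> ?w k * ennreal (C * (r / 2 ^ k) powr d)"
      using pos by (intro mult_left_mono ball) auto
    also have "\<dots> = ennreal (M * (r / 2 ^ Suc k) powr (-s) * (C * (r / 2 ^ k) powr d))"
      using pos by (simp add: ennreal_mult del: power_Suc)
    also have "M * (r / 2 ^ Suc k) powr (-s) * (C * (r / 2 ^ k) powr d)
        = M * C * 2 powr s * r powr (d - s) * q ^ k"
    proof -
      have "(r / 2 ^ Suc k) powr (-s) = ((r / 2 ^ k) / 2) powr (-s)"
        by (simp add: mult.commute)
      also have "\<dots> = (r / 2 ^ k) powr (-s) / 2 powr (-s)"
        by (rule powr_divide)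
      also have "\<dots> = 2 powr s * (r / 2 ^ k) powr (-s)"
        by (simp only: powr_minus divide_inverse inverse_inverse_eq mult.commute)
      finally have "(r / 2 ^ Suc k) powr (-s) * (r / 2 ^ k) powr d
          = 2 powr s * ((r / 2 ^ k) powr (-s) * (r / 2 ^ k) powr d)"
        by (simp only: mult.assoc)
      also have "(r / 2 ^ k) powr (-s) * (r / 2 ^ k) powr d = (r / 2 ^ k) powr (d - s)"
        by (simp only: powr_add[symmetric]) simp
      also have "\<dots> = r powr (d - s) / (2 ^ k) powr (d - s)"
        by (rule powr_divide)
      also have "(2 ^ k :: real) powr (d - s) = inverse (q ^ k)"
      proof -
        have "(2 ^ k :: real) powr (d - s) = (2 powr real k) powr (d - s)"
          by (simp only: powr_realpow zero_less_numeral)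
        also have "\<dots> = inverse ((2 powr (s - d)) powr real k)"
          unfolding powr_powr powr_minus[symmetric] by (simp add: algebra_simps)
        also have "(2 powr (s - d)) powr real k = q ^ k"
          using q(1) by (simp only: q_def powr_realpow)
        finally show ?thesis .
      qed
      also have "r powr (d - s) / inverse (q ^ k) = r powr (d - s) * q ^ k"
        by (simp only: divide_inverse inverse_inverse_eq)
      finally show ?thesis by (simp add: mult_ac)
    qed
    finally show "?w k * emeasure \<mu> (?B k) \<le> \<dots>" .
  qed
  also have "\<dots> = ennreal (\<Sum>k. M * C * 2 powr s * r powr (d - s) * q ^ k)"
    using pos q by (intro suminf_ennreal2 summable_mult summable_geometric) auto
  also have "(\<Sum>k. M * C * 2 powr s * r powr (d - s) * q ^ k)
      = M * C * 2 powr s / (1 - q) * r powr (d - s)"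
    using q by (subst suminf_mult) (auto simp: suminf_geometric summable_geometric)
  finally show ?thesis by (simp add: q_def)
qed

text \<open>
  In dimension two, \<open>s = d / 2\<close> is possible because \<open>-ln t = ln (t powr (-s)) / s\<close>
  and \<open>ln u \<le> u\<close>.
\<close>

lemma f_kernel_le_powr:
  fixes d :: real
  assumes n: "n \<ge> 2" and d: "real n - 2 < d"
  obtains M s where "M > 0" "0 < s" "s < d"
    "\<And>t. 0 < t \<Longrightarrow> t \<le> 1 \<Longrightarrow> f_kernel n t \<le> ennreal (M * t powr (-s))"
proof (cases "n = 2")
  case True
  show thesis
  proof
    show "2 / d > 0" "0 < d / 2" "d / 2 < d" using d True by auto
    fix t :: real
    assume t: "0 < t" "t \<le> 1"
    have "- (d / 2) * ln t = ln (t powr (- (d / 2)))"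
      using t by (simp add: ln_powr)
    also have "\<dots> \<le> t powr (- (d / 2))"
      using t by (intro ln_bound) simp
    finally have "\<bar>ln t\<bar> \<le> 2 / d * t powr (- (d / 2))"
      using t d True by (simp add: field_simps)
    thus "f_kernel n t \<le> ennreal (2 / d * t powr (- (d / 2)))"
      using t True by (simp add: f_kernel_def ennreal_leI)
  qed
next
  case False
  show thesis
  proof
    show "(1::real) > 0" "0 < real n - 2" "real n - 2 < d" using d n False by auto
    fix t :: real
    assume t: "0 < t" "t \<le> 1"
    have "t powi (2 - int n) = t powr (- (real n - 2))"
      using t powr_real_of_int'[of t "2 - int n"] by simp
    thus "f_kernel n t \<le> ennreal (1 * t powr (- (real n - 2)))"
      using t False by (simp add: f_kernel_def)
  qed
qed

theorem lemma3p11: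
  fixes \<mu> :: "(real ^ 'n) measure" and \<Gamma> :: "(real ^ 'n) set" and d :: real
  assumes "CARD('n) \<ge> 2"
    and "radon_measure \<mu>"
    and "measure_support \<mu> = \<Gamma>"
    and "compact \<Gamma>"
    and "real CARD('n) - 2 < d" and "d \<le> real CARD('n)"
    and "upper_regular_on \<mu> d \<Gamma>"
  shows "((\<lambda>r. SUP x. \<integral>\<^sup>+ y \<in> cball x r. f_kernel CARD('n) (dist x y) \<partial>\<mu>) \<longlongrightarrow> 0) (at_right 0)"
proof -
  have sets: "sets \<mu> = sets borel"
    using assms(2) by (simp add: radon_measure_def)
  obtain C where C: "C > 0" and
    ball: "\<And>x r. 0 < r \<Longrightarrow> r \<le> 1 / 2 \<Longrightarrow> emeasure \<mu> (cball x r) \<le> ennreal (C * r powr d)"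
    using upper_regular_all_centres[OF sets] assms(3,7) by blast
  obtain M s where M: "M > 0" "0 < s" "s < d" and
    kernel: "\<And>t. 0 < t \<Longrightarrow> t \<le> 1 \<Longrightarrow> f_kernel CARD('n) t \<le> ennreal (M * t powr (-s))"
    using f_kernel_le_powr[OF assms(1,5)] by blast
  define K where "K = M * C * 2 powr s / (1 - 2 powr (s - d))"
  have "((\<lambda>r. ennreal (K * r powr (d - s))) \<longlongrightarrow> ennreal (K * 0)) (at_right 0)"
  proof (intro tendsto_ennrealI tendsto_mult tendsto_const)
    show "((\<lambda>r. r powr (d - s)) \<longlongrightarrow> 0) (at_right 0)"
      using M by (intro tendsto_zero_powrI[where b = "d - s"])
        (auto simp: eventually_at_filter)
  qed
  hence lim: "((\<lambda>r. ennreal (K * r powr (d - s))) \<longlongrightarrow> 0) (at_right 0)" by simp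
  have bound: "\<forall>\<^sub>F r in at_right (0::real).
    (SUP x. \<integral>\<^sup>+ y \<in> cball x r. f_kernel CARD('n) (dist x y) \<partial>\<mu>) \<le> ennreal (K * r powr (d - s))"
  proof -
    have "\<forall>\<^sub>F r in at_right (0::real). r \<in> {0<..<1 / 2}"
      by (rule eventually_at_right_real) simp
    thus ?thesis
    proof eventually_elim
      case (elim r)
      hence "(\<integral>\<^sup>+ y \<in> cball x r. f_kernel CARD('n) (dist x y) \<partial>\<mu>) \<le> ennreal (K * r powr (d - s))"
        for x
        unfolding K_def
        by (intro nn_integral_singular_cball_le[OF sets] ball kernel) (use C M in auto)
      thus ?case by (intro SUP_least)
    qed
  qed
  show ?thesis
    by (rule tendsto_sandwich[OF always_eventually bound tendsto_const lim]) simp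
qed

end
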